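(* Let $n\ge 1$, let $f_i:\mathbb{R}^d\to\mathbb{R}$ be $L_i$-smooth with $L_i>0$ and $\mu$-strongly convex with $\mu>0$ for $i=1,\dots,n$, and let $\psi:\mathbb{R}^d\to\mathbb{R}\cup\{+\infty\}$ be proper, closed and convex. Let $L_{\max}=\max_i L_i$ and let $x_\ast$ be the minimizer of $P(x)=\frac1n\sum_{i=1}^n f_i(x)+\psi(x)$. If ProxRR or ProxSO is run from $x_0\in\mathbb{R}^d$ with constant stepsize $\gamma_t=\gamma$, where $0<\gamma\le\frac1{L_{\max}}$, then for every number of epochs $T\ge 0$ the iterates satisfy $$\mathbb{E}\|x_T-x_\ast\|^2\le(1-\gamma\mu)^{nT}\|x_0-x_\ast\|^2+\frac{2\gamma^2\sigma_{\mathrm{rad}}^2}{\mu},$$ where $\sigma_{\mathrm{rad}}^2=\sigma_{\mathrm{rad}}^2(\gamma)$ is the shuffling radius.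
   Context: A differentiable function $\phi:\mathbb{R}^d\to\mathbb{R}$ has Bregman divergence $D_\phi(x,y)=\phi(x)-\phi(y)-\langle\nabla\phi(y),x-y\rangle$. It is $L$-smooth if it is continuously differentiable and $D_\phi(x,y)\le\frac L2\|x-y\|^2$ for all $x,y$, and $\mu$-strongly convex if $\frac\mu2\|x-y\|^2\le D_\phi(x,y)$ for all $x,y$. Proximal operator: $\mathrm{prox}_{\eta\psi}(x)=\arg\min_{z}\{\eta\psi(z)+\frac12\|z-x\|^2\}$. Algorithm (ProxRR / ProxSO), with stepsizes $\gamma_t>0$: for each epoch $t=0,1,\dots,T-1$, take a permutation $\pi=(\pi_0,\dots,\pi_{n-1})$ of $\{1,\dots,n\}$; set $x_t^0=x_t$; for $i=0,\dots,n-1$ set $x_t^{i+1}=x_t^i-\gamma_t\nabla f_{\pi_i}(x_t^i)$; then set $x_{t+1}=\mathrm{prox}_{\gamma_t n\psi}(x_t^n)$. In ProxRR a fresh uniformly random permutation is sampled independently at every epoch; in ProxSO a single uniformly random permutation is sampled once at the start and used in all epochs. Shuffling radius: for $\gamma>0$ and a permutation $\pi$, let $x_\ast^i=x_\ast-\gamma\sum_{j=0}^{i-1}\nabla f_{\pi_j}(x_\ast)$ for $i=1,\dots,n-1$, and $$\sigma_{\mathrm{rad}}^2(\gamma)=\max_{i=1,\dots,n-1}\frac1{\gamma^2}\mathbb{E}_\pi\bigl[D_{f_{\pi_i}}(x_\ast^i,x_\ast)\bigr],$$ with expectation over a uniformly random permutation $\pi$ (a maximum over the empty set, when $n=1$,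 is $0$). *)

theory Defs
  imports "HOL-Probability.Probability" "HOL-Combinatorics.Multiset_Permutations"
begin

text \<open>The gradient is meaningful only where the function is differentiable.\<close>

definition grad :: "('a::euclidean_space \<Rightarrow> real) \<Rightarrow> 'a \<Rightarrow> 'a" where
  "grad f x = (THE g. GDERIV f x :> g)"

definition bregman :: "('a::euclidean_space \<Rightarrow> real) \<Rightarrow> 'a \<Rightarrow> 'a \<Rightarrow> real" where
  "bregman f x y = f x - f y - grad f y \<bullet> (x - y)"

definition smooth_fun :: "real \<Rightarrow> ('a::euclidean_space \<Rightarrow> real) \<Rightarrow> bool" where
  "smooth_fun L f \<longleftrightarrow>
     (\<forall>x. f differentiable (at x)) \<and> continuous_on UNIV (grad f) \<and>
     (\<forall>x y. bregman f x y \<le> L / 2 * (norm (x - y))\<^sup>2)"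

definition strongly_convex :: "real \<Rightarrow> ('a::euclidean_space \<Rightarrow> real) \<Rightarrow> bool" where
  "strongly_convex \<mu> f \<longleftrightarrow>
     (\<forall>x. f differentiable (at x)) \<and>
     (\<forall>x y. \<mu> / 2 * (norm (x - y))\<^sup>2 \<le> bregman f x y)"

text \<open>
  Extended-valued functions take values in \<open>ereal\<close>; properness rules out the value
  \<open>-\<infinity>\<close>. Closedness and convexity are those of the epigraph, which ranges over real heights.
\<close>

definition ereal_epigraph :: "('a \<Rightarrow> ereal) \<Rightarrow> ('a \<times> real) set" where
  "ereal_epigraph \<psi> = {(x, r). \<psi> x \<le> ereal r}"

definition proper_fun :: "('a \<Rightarrow> ereal) \<Rightarrow> bool" where
  "proper_fun \<psi> \<longleftrightarrow> (\<forall>x. \<psi> x \<noteq> - \<infinity>) \<and> (\<exists>x. \<psi> x \<noteq> \<infinity>)"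

definition closed_fun :: "('a::euclidean_space \<Rightarrow> ereal) \<Rightarrow> bool" where
  "closed_fun \<psi> \<longleftrightarrow> closed (ereal_epigraph \<psi>)"

definition convex_fun :: "('a::euclidean_space \<Rightarrow> ereal) \<Rightarrow> bool" where
  "convex_fun \<psi> \<longleftrightarrow> convex (ereal_epigraph \<psi>)"

definition prox :: "real \<Rightarrow> ('a::euclidean_space \<Rightarrow> ereal) \<Rightarrow> 'a \<Rightarrow> 'a" where
  "prox \<eta> \<psi> x = (ARG_MIN (\<lambda>z. ereal \<eta> * \<psi> z + ereal (1 / 2 * (norm (z - x))\<^sup>2)) z. True)"

definition composite_objective ::
    "nat \<Rightarrow> (nat \<Rightarrow> 'a::euclidean_space \<Rightarrow> real) \<Rightarrow> ('a \<Rightarrow> ereal) \<Rightarrow> 'a \<Rightarrow> ereal" where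
  "composite_objective n f \<psi> x = ereal (1 / real n * (\<Sum>i=1..n. f i x)) + \<psi> x"

text \<open>
  A permutation \<open>\<pi>\<close> of \<open>{1..n}\<close> is the list of its values, so that \<open>\<pi> ! i\<close>, for \<open>i < n\<close>, is \<open>\<pi>\<^sub>i\<close>.
\<close>

primrec inner_iterate ::
    "(nat \<Rightarrow> 'a::euclidean_space \<Rightarrow> real) \<Rightarrow> real \<Rightarrow> nat list \<Rightarrow> 'a \<Rightarrow> nat \<Rightarrow> 'a" where
  "inner_iterate f \<gamma> \<pi> x 0 = x"
| "inner_iterate f \<gamma> \<pi> x (Suc i) =
     inner_iterate f \<gamma> \<pi> x i - \<gamma> *\<^sub>R grad (f (\<pi> ! i)) (inner_iterate f \<gamma> \<pi> x i)"

text \<open>The iterate after \<open>t\<close> epochs, where epoch \<open>t\<close> uses stepsize \<open>\<gamma> t\<close> and permutation \<open>\<pi>s t\<close>.\<close>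

primrec outer_iterate ::
    "nat \<Rightarrow> (nat \<Rightarrow> 'a::euclidean_space \<Rightarrow> real) \<Rightarrow> ('a \<Rightarrow> ereal) \<Rightarrow> (nat \<Rightarrow> real) \<Rightarrow> 'a \<Rightarrow>
     (nat \<Rightarrow> nat list) \<Rightarrow> nat \<Rightarrow> 'a" where
  "outer_iterate n f \<psi> \<gamma> x0 \<pi>s 0 = x0"
| "outer_iterate n f \<psi> \<gamma> x0 \<pi>s (Suc t) =
     prox (\<gamma> t * real n) \<psi> (inner_iterate f (\<gamma> t) (\<pi>s t) (outer_iterate n f \<psi> \<gamma> x0 \<pi>s t) n)"

definition uniform_perm :: "nat \<Rightarrow> nat list pmf" where
  "uniform_perm n = pmf_of_set (permutations_of_set {1..n})"

text \<open>
  The joint law of the permutations of epochs \<open>0, \<dots>, T - 1\<close>. For random reshuffling they are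
  independent and uniform (the value \<open>[]\<close> is a dummy for epochs that are not run); for
  shuffle-once they all equal one uniform permutation.
\<close>

definition rr_schedule :: "nat \<Rightarrow> nat \<Rightarrow> (nat \<Rightarrow> nat list) pmf" where
  "rr_schedule n T = Pi_pmf {..<T} [] (\<lambda>_. uniform_perm n)"

definition so_schedule :: "nat \<Rightarrow> (nat \<Rightarrow> nat list) pmf" where
  "so_schedule n = map_pmf (\<lambda>\<pi> t. \<pi>) (uniform_perm n)"

definition opt_iterate ::
    "(nat \<Rightarrow> 'a::euclidean_space \<Rightarrow> real) \<Rightarrow> 'a \<Rightarrow> real \<Rightarrow> nat list \<Rightarrow> nat \<Rightarrow> 'a" where
  "opt_iterate f xs \<gamma> \<pi> i = xs - \<gamma> *\<^sub>R (\<Sum>j<i. grad (f (\<pi> ! j)) xs)"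

text \<open>The square of the shuffling radius; \<open>Max\<close> of the empty set is unspecified, hence the case split.\<close>

definition shuffling_radius_sq ::
    "nat \<Rightarrow> (nat \<Rightarrow> 'a::euclidean_space \<Rightarrow> real) \<Rightarrow> 'a \<Rightarrow> real \<Rightarrow> real" where
  "shuffling_radius_sq n f xs \<gamma> =
     (if n \<le> 1 then 0
      else Max ((\<lambda>i. 1 / \<gamma>\<^sup>2 * measure_pmf.expectation (uniform_perm n)
                   (\<lambda>\<pi>. bregman (f (\<pi> ! i)) (opt_iterate f xs \<gamma> \<pi> i) xs)) ` {1..<n}))"

end

theory Submission
  imports Defs
begin

text \<open>
  Within an epoch the iterate \<open>x_t^i\<close> is compared with the shifted optimum \<open>x_*^i\<close>, not with \<open>x_*\<close>.
  Expanding the square after one step, the three-point identity turns the cross term into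
  \<open>D(x_*^i, x_t^i) + D(x_t^i, x_*) - D(x_*^i, x_*)\<close>: strong convexity of the first summand gives
  the factor \<open>1 - \<gamma>\<mu>\<close>, cocoercivity lets the second absorb the squared gradient difference,
  and the third has expectation at most \<open>\<gamma>\<^sup>2 \<sigma>\<^sub>r\<^sub>a\<^sub>d\<^sup>2\<close>. For every permutation \<open>x_*\<close> is the
  proximal point of \<open>x_*^n\<close>, so the proximal step closes the epoch without loss. Summing the
  geometric series of noise terms gives \<open>2\<gamma>\<^sup>2\<sigma>\<^sub>r\<^sub>a\<^sub>d\<^sup>2 / \<mu>\<close>.
\<close>

section \<open>Bregman divergences and a single gradient step\<close>

lemma bregman_three_point:
  "(grad f x - grad f y) \<bullet> (x - z) = bregman f z x + bregman f x y - bregman f z y"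
  unfolding bregman_def by (simp add: inner_diff_left inner_diff_right)

lemma bregman_nonneg:
  assumes "strongly_convex \<mu> f" "\<mu> > 0"
  shows "bregman f x y \<ge> 0"
proof -
  have "0 \<le> \<mu> / 2 * (norm (x - y))\<^sup>2" using assms(2) by simp
  also have "\<dots> \<le> bregman f x y" using assms(1) unfolding strongly_convex_def by blast
  finally show ?thesis .
qed

text \<open>It suffices to compare the two quadratic bounds at distance 1, and a Euclidean space has
  a basis vector at that distance from 0. This later makes the contraction factor
  \<open>1 - \<gamma> * \<mu>\<close> nonnegative.\<close>

lemma strongly_convex_le_smooth:
  fixes f :: "'a::euclidean_space \<Rightarrow> real"
  assumes "strongly_convex \<mu> f" "smooth_fun L f"
  shows "\<mu> \<le> L"
proof -
  obtain b :: 'a where "b \<in> Basis" using nonempty_Basis by blast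
  then have "norm (b - 0) = 1" by simp
  moreover have "\<mu> / 2 * (norm (b - 0))\<^sup>2 \<le> L / 2 * (norm (b - 0))\<^sup>2"
    using assms order_trans unfolding strongly_convex_def smooth_fun_def by blast
  ultimately show ?thesis by simp
qed

text \<open>A gradient step from \<open>x\<close> on the function \<open>bregman f \<cdot> y\<close>, whose minimum is \<open>0\<close>.\<close>

lemma bregman_cocoercive:
  assumes "smooth_fun L f" "L > 0" "\<And>x y. bregman f x y \<ge> 0"
  shows "(norm (grad f x - grad f y))\<^sup>2 \<le> 2 * L * bregman f x y"
proof -
  define g where "g = grad f x - grad f y"
  define z where "z = x - (1 / L) *\<^sub>R g"
  have "bregman f z x \<le> L / 2 * (norm (z - x))\<^sup>2"
    using assms(1) unfolding smooth_fun_def by blast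
  also have "\<dots> = 1 / (2 * L) * (norm g)\<^sup>2"
    using assms(2) by (simp add: z_def power_divide power2_eq_square)
  finally have 1: "bregman f z x \<le> 1 / (2 * L) * (norm g)\<^sup>2" .
  have "g \<bullet> (x - z) = 1 / L * (norm g)\<^sup>2"
    by (simp add: z_def power2_norm_eq_inner)
  with bregman_three_point[of f x y z] assms(3)[of z y]
  have "1 / L * (norm g)\<^sup>2 \<le> bregman f z x + bregman f x y" by (simp add: g_def)
  with 1 show ?thesis using assms(2) by (simp add: g_def field_simps)
qed

text \<open>The reference point \<open>y\<close> moves along \<open>grad f xs\<close> and not
  \<open>grad f y\<close>, as the shifted optimum does; \<open>bregman f y xs\<close> is the price
  of this mismatch.\<close>

lemma gradient_step_contraction:
  assumes sm: "smooth_fun L f" and L: "L > 0" and sc: "strongly_convex \<mu> f" and mu: "\<mu> > 0"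
    and g: "0 \<le> \<gamma>" "\<gamma> * L \<le> 1"
  shows "(norm ((x - \<gamma> *\<^sub>R grad f x) - (y - \<gamma> *\<^sub>R grad f xs)))\<^sup>2
    \<le> (1 - \<gamma> * \<mu>) * (norm (x - y))\<^sup>2 + 2 * \<gamma> * bregman f y xs"
proof -
  define d where "d = grad f x - grad f xs"
  have nonneg: "bregman f u v \<ge> 0" for u v using bregman_nonneg[OF sc mu] .
  have "(norm ((x - \<gamma> *\<^sub>R grad f x) - (y - \<gamma> *\<^sub>R grad f xs)))\<^sup>2 = (norm ((x - y) - \<gamma> *\<^sub>R d))\<^sup>2"
    by (simp add: d_def algebra_simps)
  also have "\<dots> = (norm (x - y))\<^sup>2 - 2 * \<gamma> * (d \<bullet> (x - y)) + \<gamma> * (\<gamma> * (norm d)\<^sup>2)"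
    unfolding power2_norm_eq_inner
    by (simp add: inner_diff_left inner_diff_right inner_commute algebra_simps)
  also have "d \<bullet> (x - y) = bregman f y x + bregman f x xs - bregman f y xs"
    unfolding d_def by (rule bregman_three_point)
  finally have eq: "(norm ((x - \<gamma> *\<^sub>R grad f x) - (y - \<gamma> *\<^sub>R grad f xs)))\<^sup>2
     = (norm (x - y))\<^sup>2 - 2 * \<gamma> * (bregman f y x + bregman f x xs - bregman f y xs)
       + \<gamma> * (\<gamma> * (norm d)\<^sup>2)" .
  \<comment> \<open>Cocoercivity and \<open>\<gamma> * L \<le> 1\<close> bound the squared gradient
    term by exactly the multiple of \<open>bregman f x xs\<close> that the cross term
    subtracts.\<close>
  have "\<gamma> * (norm d)\<^sup>2 \<le> \<gamma> * (2 * L * bregman f x xs)"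
    using bregman_cocoercive[OF sm L nonneg, of x xs] g unfolding d_def
    by (intro mult_left_mono) auto
  also have "\<dots> = (\<gamma> * L) * (2 * bregman f x xs)" by simp
  also have "\<dots> \<le> 1 * (2 * bregman f x xs)"
    using g nonneg by (intro mult_right_mono) auto
  finally have 1: "\<gamma> * (\<gamma> * (norm d)\<^sup>2) \<le> \<gamma> * (2 * bregman f x xs)"
    using g by (intro mult_left_mono) auto
  have "\<mu> / 2 * (norm (y - x))\<^sup>2 \<le> bregman f y x"
    using sc unfolding strongly_convex_def by blast
  then have "2 * \<gamma> * (\<mu> / 2 * (norm (x - y))\<^sup>2) \<le> 2 * \<gamma> * bregman f y x"
    using g by (intro mult_left_mono) (auto simp: norm_minus_commute)
  with 1 eq show ?thesis by (simp add: algebra_simps)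
qed

section \<open>Convex optimality and the proximal operator\<close>

lemma convex_fun_segment:
  assumes "convex_fun \<psi>" "\<psi> z = ereal a" "\<psi> w = ereal b" "0 \<le> s" "s \<le> 1"
  shows "\<psi> (z + s *\<^sub>R (w - z)) \<le> ereal (a + s * (b - a))"
proof -
  have "(z, a) \<in> ereal_epigraph \<psi>" "(w, b) \<in> ereal_epigraph \<psi>"
    using assms by (auto simp: ereal_epigraph_def)
  then have "(1 - s) *\<^sub>R (z, a) + s *\<^sub>R (w, b) \<in> ereal_epigraph \<psi>"
    using assms unfolding convex_fun_def by (intro convexD) auto
  then have "\<psi> ((1 - s) *\<^sub>R z + s *\<^sub>R w) \<le> ereal ((1 - s) * a + s * b)"
    by (simp add: ereal_epigraph_def)
  then show ?thesis by (simp add: algebra_simps)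
qed

text \<open>
  First-order optimality for \<open>\<eta>\<psi> + h\<close>: compare \<open>z\<close> with \<open>z + s (w - z)\<close>, divide by \<open>s\<close> and let
  \<open>s\<close> tend to \<open>0\<close>. The quadratic upper bound replaces differentiability of \<open>h\<close>.
\<close>

lemma subgradient_of_minimizer:
  fixes z :: "'a::euclidean_space"
  assumes cvx: "convex_fun \<psi>" and eta: "\<eta> > 0"
    and min: "is_arg_min (\<lambda>u. ereal \<eta> * \<psi> u + ereal (h u)) (\<lambda>_. True) z"
    and h: "\<And>u. h u - h z - g \<bullet> (u - z) \<le> C * (norm (u - z))\<^sup>2"
    and z: "\<psi> z = ereal a" and w: "\<psi> w = ereal b"
  shows "\<eta> * (a - b) \<le> g \<bullet> (w - z)"
proof -
  define K where "K = C * (norm (w - z))\<^sup>2"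
  have ineq: "\<eta> * (a - b) \<le> g \<bullet> (w - z) + s * K" if s: "0 < s" "s \<le> 1" for s
  proof -
    define u where "u = z + s *\<^sub>R (w - z)"
    have "ereal \<eta> * \<psi> z + ereal (h z) \<le> ereal \<eta> * \<psi> u + ereal (h u)"
      using min unfolding is_arg_min_def by (auto simp: not_less)
    also have "\<dots> \<le> ereal \<eta> * ereal (a + s * (b - a)) + ereal (h u)"
      using convex_fun_segment[OF cvx z w, of s] s eta unfolding u_def
      by (intro add_right_mono ereal_mult_left_mono) auto
    finally have "\<eta> * a + h z \<le> \<eta> * (a + s * (b - a)) + h u" using z by simp
    moreover have "h u - h z \<le> s * (g \<bullet> (w - z)) + s * (s * K)"
    proof -
      have "u - z = s *\<^sub>R (w - z)" by (simp add: u_def)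
      then have "h u - h z - s * (g \<bullet> (w - z)) \<le> C * (s * norm (w - z))\<^sup>2"
        using h[of u] s by simp
      then show ?thesis by (simp add: K_def power_mult_distrib power2_eq_square algebra_simps)
    qed
    ultimately have "s * (\<eta> * (a - b)) \<le> s * (g \<bullet> (w - z) + s * K)"
      by (simp add: algebra_simps)
    then show ?thesis using s by simp
  qed
  have "((\<lambda>s. g \<bullet> (w - z) + s * K) \<longlongrightarrow> g \<bullet> (w - z) + 0 * K) (at_right 0)"
    by (intro tendsto_intros)
  moreover have "eventually (\<lambda>s. \<eta> * (a - b) \<le> g \<bullet> (w - z) + s * K) (at_right (0::real))"
    unfolding eventually_at_right_field using ineq by (intro exI[of _ 1]) auto
  ultimately show ?thesis by (auto intro: tendsto_lowerbound)
qed

text \<open>\<open>prox\<close> is a choice by \<open>ARG_MIN\<close>, so it is meaningful only once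
  some minimizer exists. The affine minorant makes the quadratically penalized objective coercive,
  and closedness of the epigraph then gives a compact set to minimize over.\<close>

lemma prox_is_arg_min:
  fixes \<psi> :: "'a::euclidean_space \<Rightarrow> ereal"
  assumes cl: "closed_fun \<psi>" and eta: "\<eta> > 0" and y: "\<psi> y = ereal a"
    and minorant: "\<And>w. ereal (a + g \<bullet> (w - y)) \<le> \<psi> w"
  shows "is_arg_min (\<lambda>z. ereal \<eta> * \<psi> z + ereal (1 / 2 * (norm (z - x))\<^sup>2)) (\<lambda>_. True) (prox \<eta> \<psi> x)"
proof -
  \<comment> \<open>Replacing \<open>\<psi> z\<close> by a height \<open>r\<close> over the epigraph
    turns the extended-valued, possibly discontinuous objective into a continuous real one.\<close>
  define v where "v = (\<lambda>(z, r). \<eta> * r + 1 / 2 * (norm (z - x))\<^sup>2)"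
  define c where "c = v (y, a)"
  define K where "K = ereal_epigraph \<psi> \<inter> {p. v p \<le> c}"
  have cont: "continuous_on S v" for S
    unfolding v_def case_prod_unfold by (intro continuous_intros)
  have "closed K"
    unfolding K_def using cl cont unfolding closed_fun_def
    by (intro closed_Int closed_Collect_le continuous_intros) auto
  moreover have "bounded K"
  proof -
    \<comment> \<open>Completing the square in \<eta> times the minorant plus half the squared
      distance to \<open>x\<close> gives the centre \<open>m\<close> and the squared radius
      \<open>M\<close>.\<close>
    define M where "M = 2 * c - 2 * \<eta> * (a + g \<bullet> (x - y)) + \<eta>\<^sup>2 * (norm g)\<^sup>2"
    define m where "m = x - \<eta> *\<^sub>R g"
    have "K \<subseteq> cball m (sqrt M) \<times> {a + g \<bullet> (m - y) - norm g * sqrt M .. c / \<eta>}"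
    proof clarify
      fix z r assume zr: "(z, r) \<in> K"
      then have v: "\<eta> * r + 1 / 2 * (norm (z - x))\<^sup>2 \<le> c" and "\<psi> z \<le> ereal r"
        by (auto simp: K_def v_def ereal_epigraph_def)
      with minorant[of z] have r: "a + g \<bullet> (z - y) \<le> r"
        by (metis ereal_less_eq(3) order_trans)
      then have "\<eta> * (a + g \<bullet> (z - y)) \<le> \<eta> * r" using eta by simp
      with v have "2 * \<eta> * (a + g \<bullet> (z - y)) + (norm (z - x))\<^sup>2 \<le> 2 * c" by simp
      moreover have "(norm (z - m))\<^sup>2 = (norm (z - x))\<^sup>2 + 2 * \<eta> * (g \<bullet> (z - x)) + \<eta>\<^sup>2 * (norm g)\<^sup>2"
        unfolding m_def power2_norm_eq_inner
        by (simp add: inner_diff_left inner_diff_right inner_add_left inner_add_right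
            inner_commute power2_eq_square algebra_simps)
      ultimately have "(norm (z - m))\<^sup>2 \<le> M"
        unfolding M_def by (simp add: inner_diff_right algebra_simps)
      then have nz: "norm (z - m) \<le> sqrt M" using real_le_rsqrt by blast
      \<comment> \<open>On this ball the minorant bounds the height from below; the level
        \<open>c\<close> bounds it from above.\<close>
      have "- (g \<bullet> (z - m)) \<le> norm g * norm (z - m)"
        using norm_cauchy_schwarz[of "- g" "z - m"] by simp
      also have "\<dots> \<le> norm g * sqrt M" using nz by (intro mult_left_mono) auto
      finally have "a + g \<bullet> (m - y) - norm g * sqrt M \<le> r"
        using r by (simp add: inner_diff_right)
      moreover have "r \<le> c / \<eta>"
      proof -
        have "\<eta> * r \<le> c" using v zero_le_power2[of "norm (z - x)"] by linarith
        then show ?thesis using eta by (simp add: field_simps)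
      qed
      ultimately show "z \<in> cball m (sqrt M) \<and> r \<in> {a + g \<bullet> (m - y) - norm g * sqrt M .. c / \<eta>}"
        using nz by (simp add: dist_norm norm_minus_commute)
    qed
    then show ?thesis by (rule bounded_subset[rotated]) (intro bounded_Times bounded_cball bounded_closed_interval)
  qed
  ultimately have "compact K" by (simp add: compact_eq_bounded_closed)
  moreover have "(y, a) \<in> K" using y by (simp add: K_def c_def ereal_epigraph_def)
  ultimately obtain p where p: "p \<in> K" and pmin: "\<And>q. q \<in> K \<Longrightarrow> v p \<le> v q"
    using continuous_attains_inf[OF _ _ cont] by (metis empty_iff)
  obtain z r where pz: "p = (z, r)" by (cases p)
  have "ereal \<eta> * \<psi> z + ereal (1 / 2 * (norm (z - x))\<^sup>2) \<le> ereal (v p)"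
  proof -
    have "ereal \<eta> * \<psi> z + ereal (1 / 2 * (norm (z - x))\<^sup>2)
      \<le> ereal \<eta> * ereal r + ereal (1 / 2 * (norm (z - x))\<^sup>2)"
      using p eta unfolding pz K_def ereal_epigraph_def
      by (intro add_right_mono ereal_mult_left_mono) auto
    then show ?thesis by (simp add: v_def pz)
  qed
  moreover have "ereal (v p) \<le> ereal \<eta> * \<psi> w + ereal (1 / 2 * (norm (w - x))\<^sup>2)" for w
  proof (cases "\<psi> w")
    case (real b)
    then have "(w, b) \<in> ereal_epigraph \<psi>" by (simp add: ereal_epigraph_def)
    \<comment> \<open>An epigraph point outside \<open>K\<close> has value above \<open>c\<close>,
      and \<open>v p\<close> is at most \<open>c\<close>.\<close>
    then have "v p \<le> v (w, b)"
      using pmin[of "(w, b)"] p by (cases "v (w, b) \<le> c") (auto simp: K_def)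
    then show ?thesis by (simp add: real v_def)
  next
    case PInf
    then show ?thesis using eta by simp
  next
    case MInf
    then show ?thesis using minorant[of w] by simp
  qed
  ultimately have "is_arg_min (\<lambda>z. ereal \<eta> * \<psi> z + ereal (1 / 2 * (norm (z - x))\<^sup>2)) (\<lambda>_. True) z"
    unfolding is_arg_min_def by (metis leD order_trans)
  then show ?thesis unfolding prox_def arg_min_def by (rule someI)
qed

lemma norm_sq_quadratic:
  fixes u x z :: "'a::real_inner"
  shows "1 / 2 * (norm (u - x))\<^sup>2 - 1 / 2 * (norm (z - x))\<^sup>2 - (z - x) \<bullet> (u - z)
    = 1 / 2 * (norm (u - z))\<^sup>2"
  unfolding power2_norm_eq_inner
  by (simp add: inner_diff_left inner_diff_right inner_commute algebra_simps)

text \<open>Since \<open>g\<close> is a subgradient at \<open>y\<close>, the point \<open>y\<close>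
  is itself the proximal point of \<open>y + \<eta> *\<^sub>R g\<close>. Adding the optimality
  inequality at the proximal point of \<open>x\<close> to the minorant inequality cancels the values
  of \<psi>, and Cauchy-Schwarz finishes.\<close>

lemma prox_nonexpansive_at:
  fixes \<psi> :: "'a::euclidean_space \<Rightarrow> ereal"
  assumes proper: "proper_fun \<psi>" and cl: "closed_fun \<psi>" and cvx: "convex_fun \<psi>"
    and eta: "\<eta> > 0" and y: "\<psi> y = ereal a"
    and minorant: "\<And>w. ereal (a + g \<bullet> (w - y)) \<le> \<psi> w"
  shows "norm (prox \<eta> \<psi> x - y) \<le> norm (x - (y + \<eta> *\<^sub>R g))"
proof -
  define p where "p = prox \<eta> \<psi> x"
  have min: "is_arg_min (\<lambda>z. ereal \<eta> * \<psi> z + ereal (1 / 2 * (norm (z - x))\<^sup>2)) (\<lambda>_. True) p"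
    unfolding p_def by (rule prox_is_arg_min[OF cl eta y minorant])
  then have "ereal \<eta> * \<psi> p + ereal (1 / 2 * (norm (p - x))\<^sup>2)
      \<le> ereal \<eta> * \<psi> y + ereal (1 / 2 * (norm (y - x))\<^sup>2)"
    unfolding is_arg_min_def by (auto simp: not_less)
  with y eta have "\<psi> p \<noteq> \<infinity>" by auto
  moreover have "\<psi> p \<noteq> -\<infinity>" using proper unfolding proper_fun_def by blast
  ultimately obtain b where b: "\<psi> p = ereal b" by (cases "\<psi> p") auto
  \<comment> \<open>Here \<open>h\<close> is half the squared distance to \<open>x\<close>, with
    gradient \<open>p - x\<close> at \<open>p\<close>; its quadratic bound with constant 1/2 is an
    equality.\<close>
  have "\<eta> * (b - a) \<le> (p - x) \<bullet> (y - p)"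
    by (rule subgradient_of_minimizer[OF cvx eta min _ b y, where C = "1 / 2"])
      (simp only: norm_sq_quadratic order_refl)
  moreover have "\<eta> * (a + g \<bullet> (p - y)) \<le> \<eta> * b"
    using minorant[of p] b eta by simp
  ultimately have "(norm (p - y))\<^sup>2 \<le> (p - y) \<bullet> (x - (y + \<eta> *\<^sub>R g))"
    unfolding power2_norm_eq_inner
    by (simp add: inner_diff_left inner_diff_right inner_add_right inner_commute algebra_simps)
  also have "\<dots> \<le> norm (p - y) * norm (x - (y + \<eta> *\<^sub>R g))" by (rule norm_cauchy_schwarz)
  finally show ?thesis
    unfolding p_def[symmetric] by (cases "norm (p - y) = 0") (auto simp: power2_eq_square)
qed

section \<open>Uniform random permutations\<close>

lemma uniform_perm_support:
  assumes "\<pi> \<in> set_pmf (uniform_perm n)"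
  shows "length \<pi> = n" "distinct \<pi>" "set \<pi> = {1..n}"
proof -
  have "set_pmf (uniform_perm n) = permutations_of_set {1..n}"
    unfolding uniform_perm_def by (intro set_pmf_of_set) auto
  with assms have "\<pi> \<in> permutations_of_set {1..n}" by simp
  then show "distinct \<pi>" "set \<pi> = {1..n}" by (auto dest: permutations_of_setD)
  then show "length \<pi> = n" using distinct_card by fastforce
qed

lemma finite_uniform_perm: "finite (set_pmf (uniform_perm n))"
  unfolding uniform_perm_def by (subst set_pmf_of_set) auto

section \<open>The run against the shifted optimum: one epoch, then expectations\<close>

locale prox_shuffling =
  fixes f :: "nat \<Rightarrow> 'a::euclidean_space \<Rightarrow> real"
    and \<psi> :: "'a \<Rightarrow> ereal"
    and L :: "nat \<Rightarrow> real"
    and \<mu> \<gamma> :: real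
    and n :: nat
    and xs :: 'a
  assumes n: "n \<ge> 1"
    and L: "\<And>i. i \<in> {1..n} \<Longrightarrow> L i > 0"
    and smooth: "\<And>i. i \<in> {1..n} \<Longrightarrow> smooth_fun (L i) (f i)"
    and mu: "\<mu> > 0"
    and sconvex: "\<And>i. i \<in> {1..n} \<Longrightarrow> strongly_convex \<mu> (f i)"
    and proper: "proper_fun \<psi>" and closed: "closed_fun \<psi>" and convex: "convex_fun \<psi>"
    and min: "is_arg_min (composite_objective n f \<psi>) (\<lambda>_. True) xs"
    and gamma_pos: "0 < \<gamma>" and gamma: "\<gamma> \<le> 1 / Max (L ` {1..n})"
begin

abbreviation \<sigma>sq :: real where "\<sigma>sq \<equiv> shuffling_radius_sq n f xs \<gamma>"

definition noise :: "nat list \<Rightarrow> nat \<Rightarrow> real" where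
  "noise \<pi> i = bregman (f (\<pi> ! i)) (opt_iterate f xs \<gamma> \<pi> i) xs"

lemma gamma_L: "i \<in> {1..n} \<Longrightarrow> \<gamma> * L i \<le> 1"
proof -
  assume i: "i \<in> {1..n}"
  then have "L i \<le> Max (L ` {1..n})" by (intro Max_ge) auto
  moreover from this have "Max (L ` {1..n}) > 0" using L[OF i] by linarith
  ultimately have "\<gamma> * L i \<le> 1 / Max (L ` {1..n}) * Max (L ` {1..n})"
    using gamma gamma_pos L[OF i] by (intro mult_mono) auto
  then show ?thesis using \<open>Max (L ` {1..n}) > 0\<close> by simp
qed

lemma contraction_factor: "0 \<le> 1 - \<gamma> * \<mu>"
proof -
  have one: "1 \<in> {1..n}" using n by simp
  have "\<gamma> * \<mu> \<le> \<gamma> * L 1"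
    using strongly_convex_le_smooth[OF sconvex smooth] one gamma_pos by (intro mult_left_mono) auto
  with gamma_L[OF one] show ?thesis by simp
qed

lemma noise_nonneg: "\<pi> ! i \<in> {1..n} \<Longrightarrow> 0 \<le> noise \<pi> i"
  unfolding noise_def using bregman_nonneg sconvex mu by blast

lemma psi_minimizer: obtains a where "\<psi> xs = ereal a"
proof -
  obtain w where "\<psi> w \<noteq> \<infinity>" using proper unfolding proper_fun_def by blast
  moreover have "composite_objective n f \<psi> xs \<le> composite_objective n f \<psi> w"
    using min unfolding is_arg_min_def by (auto simp: not_less)
  ultimately have "\<psi> xs \<noteq> \<infinity>" unfolding composite_objective_def by auto
  moreover have "\<psi> xs \<noteq> -\<infinity>" using proper unfolding proper_fun_def by blast
  ultimately show ?thesis using that by (cases "\<psi> xs") auto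
qed

text \<open>First-order optimality of \<open>xs\<close>, with \<eta> = 1 and the average of the
  \<open>f i\<close> as smooth part: averaging the smoothness inequalities supplies the quadratic
  upper bound. The resulting subgradient of \<psi> is what the proximal lemmas take as
  \<open>g\<close>.\<close>

lemma psi_minorant:
  assumes a: "\<psi> xs = ereal a"
  shows "ereal (a + (- ((1 / real n) *\<^sub>R (\<Sum>i=1..n. grad (f i) xs))) \<bullet> (w - xs)) \<le> \<psi> w"
proof (cases "\<psi> w")
  case (real b)
  define h where "h u = 1 / real n * (\<Sum>i=1..n. f i u)" for u
  define g where "g = (1 / real n) *\<^sub>R (\<Sum>i=1..n. grad (f i) xs)"
  define C where "C = 1 / real n * (\<Sum>i=1..n. L i / 2)"
  have bound: "h u - h xs - g \<bullet> (u - xs) \<le> C * (norm (u - xs))\<^sup>2" for u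
  proof -
    have "h u - h xs - g \<bullet> (u - xs) = 1 / real n * (\<Sum>i=1..n. bregman (f i) u xs)"
      by (simp add: h_def g_def bregman_def inner_sum_left sum_subtractf diff_divide_distrib)
    also have "\<dots> \<le> 1 / real n * (\<Sum>i=1..n. L i / 2 * (norm (u - xs))\<^sup>2)"
      using smooth unfolding smooth_fun_def by (intro mult_left_mono sum_mono) auto
    also have "\<dots> = C * (norm (u - xs))\<^sup>2"
      unfolding C_def by (simp only: sum_distrib_right[symmetric] mult.assoc)
    finally show ?thesis .
  qed
  have "composite_objective n f \<psi> = (\<lambda>u. ereal 1 * \<psi> u + ereal (h u))"
    by (auto simp: composite_objective_def h_def add.commute simp flip: one_ereal_def)
  with min have "is_arg_min (\<lambda>u. ereal 1 * \<psi> u + ereal (h u)) (\<lambda>_. True) xs" by simp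
  from subgradient_of_minimizer[OF convex _ this bound a real]
  show ?thesis by (simp add: real g_def)
next
  case MInf
  then show ?thesis using proper unfolding proper_fun_def by blast
qed auto

text \<open>A full pass uses each gradient at \<open>xs\<close> once, so the endpoint of the shifted
  optimum does not depend on the order, and it is \<open>xs\<close> plus
  \<open>\<gamma> * real n\<close> times the subgradient from \<open>psi_minorant\<close>.\<close>

lemma prox_step:
  assumes "\<pi> \<in> set_pmf (uniform_perm n)"
  shows "norm (prox (\<gamma> * real n) \<psi> x - xs) \<le> norm (x - opt_iterate f xs \<gamma> \<pi> n)"
proof -
  note \<pi> = uniform_perm_support[OF assms]
  obtain a where a: "\<psi> xs = ereal a" by (rule psi_minimizer)
  have "(\<Sum>j<n. grad (f (\<pi> ! j)) xs) = (\<Sum>i=1..n. grad (f i) xs)"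
    using \<pi> by (intro sum.reindex_bij_betw bij_betw_nth) auto
  then have "xs + (\<gamma> * real n) *\<^sub>R (- ((1 / real n) *\<^sub>R (\<Sum>i=1..n. grad (f i) xs)))
      = opt_iterate f xs \<gamma> \<pi> n"
    using n by (simp add: opt_iterate_def)
  with prox_nonexpansive_at[OF proper closed convex _ a psi_minorant[OF a], of "\<gamma> * real n" x]
  show ?thesis using n gamma_pos by simp
qed

text \<open>Unrolling the one-step contraction: noise created at step \<open>i\<close> is damped by
  the \<open>k - Suc i\<close> steps that follow.\<close>

lemma inner_iterate_bound:
  assumes \<pi>: "\<pi> \<in> set_pmf (uniform_perm n)" and "k \<le> n"
  shows "(norm (inner_iterate f \<gamma> \<pi> x k - opt_iterate f xs \<gamma> \<pi> k))\<^sup>2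
    \<le> (1 - \<gamma> * \<mu>) ^ k * (norm (x - xs))\<^sup>2
      + 2 * \<gamma> * (\<Sum>i<k. (1 - \<gamma> * \<mu>) ^ (k - Suc i) * noise \<pi> i)"
  using assms(2)
proof (induction k)
  case 0
  then show ?case by (simp add: opt_iterate_def)
next
  case (Suc k)
  let ?q = "1 - \<gamma> * \<mu>"
  let ?y = "opt_iterate f xs \<gamma> \<pi> k" and ?x = "inner_iterate f \<gamma> \<pi> x k" and ?j = "\<pi> ! k"
  have j: "?j \<in> {1..n}"
    using uniform_perm_support[OF \<pi>] Suc.prems by (metis Suc_le_lessD nth_mem)
  have "opt_iterate f xs \<gamma> \<pi> (Suc k) = ?y - \<gamma> *\<^sub>R grad (f ?j) xs"
    by (simp add: opt_iterate_def algebra_simps)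
  then have "(norm (inner_iterate f \<gamma> \<pi> x (Suc k) - opt_iterate f xs \<gamma> \<pi> (Suc k)))\<^sup>2
      \<le> ?q * (norm (?x - ?y))\<^sup>2 + 2 * \<gamma> * noise \<pi> k"
    using gradient_step_contraction[OF smooth[OF j] L[OF j] sconvex[OF j] mu _ gamma_L[OF j]]
      gamma_pos by (simp add: noise_def)
  also have "\<dots> \<le> ?q * (?q ^ k * (norm (x - xs))\<^sup>2
      + 2 * \<gamma> * (\<Sum>i<k. ?q ^ (k - Suc i) * noise \<pi> i)) + 2 * \<gamma> * noise \<pi> k"
    using Suc contraction_factor by (intro add_right_mono mult_left_mono) auto
  also have "\<dots> = ?q ^ Suc k * (norm (x - xs))\<^sup>2
      + 2 * \<gamma> * ((\<Sum>i<k. ?q * (?q ^ (k - Suc i) * noise \<pi> i)) + noise \<pi> k)"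
    by (simp only: sum_distrib_left[symmetric] power_Suc) (simp only: algebra_simps)
  \<comment> \<open>Because \<open>i < k\<close>, the truncated subtraction is exact and the
    exponent really grows by one.\<close>
  also have "(\<Sum>i<k. ?q * (?q ^ (k - Suc i) * noise \<pi> i)) = (\<Sum>i<k. ?q ^ (Suc k - Suc i) * noise \<pi> i)"
    by (intro sum.cong refl)
      (simp only: mult.assoc[symmetric] power_Suc[symmetric] Suc_diff_Suc lessThan_iff diff_Suc_Suc)
  finally show ?case by simp
qed

text \<open>The radius is a maximum over the indices from 1 to \<open>n - 1\<close>. Index 0 fits
  under the same bound because the shifted optimum starts at \<open>xs\<close>, where the divergence
  vanishes, and the radius is nonnegative.\<close>

lemma expectation_noise:
  assumes "i < n"
  shows "measure_pmf.expectation (uniform_perm n) (\<lambda>\<pi>. noise \<pi> i) \<le> \<gamma>\<^sup>2 * \<sigma>sq"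
proof -
  define E where "E i = measure_pmf.expectation (uniform_perm n) (\<lambda>\<pi>. noise \<pi> i)" for i
  have E: "E j \<le> \<gamma>\<^sup>2 * \<sigma>sq" if j: "j \<in> {1..<n}" for j
  proof -
    have "\<sigma>sq = Max ((\<lambda>i. 1 / \<gamma>\<^sup>2 * E i) ` {1..<n})"
      using j by (auto simp: shuffling_radius_sq_def E_def noise_def)
    then have "1 / \<gamma>\<^sup>2 * E j \<le> \<sigma>sq" using j by (simp only:) (intro Max_ge, auto)
    then show ?thesis using gamma_pos by (simp add: field_simps)
  qed
  have E_nonneg: "0 \<le> E j" if "j < n" for j
  proof -
    have "\<pi> ! j \<in> {1..n}" if "\<pi> \<in> set_pmf (uniform_perm n)" for \<pi>
      using uniform_perm_support[OF that] \<open>j < n\<close> by (metis nth_mem)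
    then show ?thesis unfolding E_def
      by (intro integral_nonneg_AE) (auto simp: AE_measure_pmf_iff intro: noise_nonneg)
  qed
  show ?thesis
  proof (cases "i = 0")
    case True
    have "E 0 = 0" by (simp add: E_def noise_def opt_iterate_def bregman_def)
    moreover have "0 \<le> \<gamma>\<^sup>2 * \<sigma>sq"
    proof (cases "n = 1")
      case False
      then have "1 \<in> {1..<n}" "1 < n" using n by auto
      then show ?thesis using E[of 1] E_nonneg[of 1] by linarith
    qed (simp add: shuffling_radius_sq_def)
    ultimately show ?thesis using True by (simp add: E_def)
  qed (use E assms in \<open>simp add: E_def\<close>)
qed

text \<open>Bounding each expected noise uniformly leaves a geometric sum, which equals
  \<open>1 - (1 - \<gamma> * \<mu>) ^ n\<close> divided by \<open>\<gamma> * \<mu>\<close>. The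
  factor is kept in this form so that the noise bound is reproduced from epoch to epoch.\<close>

lemma epoch_noise:
  "measure_pmf.expectation (uniform_perm n)
      (\<lambda>\<pi>. 2 * \<gamma> * (\<Sum>i<n. (1 - \<gamma> * \<mu>) ^ (n - Suc i) * noise \<pi> i))
    \<le> (1 - (1 - \<gamma> * \<mu>) ^ n) * (2 * \<gamma>\<^sup>2 * \<sigma>sq / \<mu>)"
proof -
  let ?q = "1 - \<gamma> * \<mu>"
  note int = integrable_measure_pmf_finite[OF finite_uniform_perm]
  have "measure_pmf.expectation (uniform_perm n) (\<lambda>\<pi>. 2 * \<gamma> * (\<Sum>i<n. ?q ^ (n - Suc i) * noise \<pi> i))
      = 2 * \<gamma> * (\<Sum>i<n. ?q ^ (n - Suc i) * measure_pmf.expectation (uniform_perm n) (\<lambda>\<pi>. noise \<pi> i))"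
    by (simp add: Bochner_Integration.integral_sum int)
  also have "\<dots> \<le> 2 * \<gamma> * (\<Sum>i<n. ?q ^ (n - Suc i) * (\<gamma>\<^sup>2 * \<sigma>sq))"
    using gamma_pos contraction_factor expectation_noise
    by (intro mult_left_mono sum_mono) auto
  also have "\<dots> = 2 * \<gamma> * ((\<Sum>i<n. ?q ^ i) * (\<gamma>\<^sup>2 * \<sigma>sq))"
    by (simp only: sum_distrib_right[symmetric] sum.nat_diff_reindex[of "\<lambda>i. ?q ^ i" n])
  also have "\<dots> = (1 - ?q ^ n) * (2 * \<gamma>\<^sup>2 * \<sigma>sq / \<mu>)"
  proof -
    have "1 - ?q ^ n = \<gamma> * \<mu> * (\<Sum>i<n. ?q ^ i)"
      using one_diff_power_eq[of ?q n] by simp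
    then show ?thesis using mu by (simp add: power2_eq_square)
  qed
  finally show ?thesis .
qed

lemma epoch_bound:
  assumes "\<pi> \<in> set_pmf (uniform_perm n)"
  shows "(norm (prox (\<gamma> * real n) \<psi> (inner_iterate f \<gamma> \<pi> x n) - xs))\<^sup>2
    \<le> (1 - \<gamma> * \<mu>) ^ n * (norm (x - xs))\<^sup>2
      + 2 * \<gamma> * (\<Sum>i<n. (1 - \<gamma> * \<mu>) ^ (n - Suc i) * noise \<pi> i)"
  using power_mono[where n = 2, OF prox_step[OF assms] norm_ge_zero] inner_iterate_bound[OF assms order_refl]
  by (rule order_trans)

text \<open>
  By linearity of expectation only the marginal law of each epoch's permutation matters,
  so independent and repeated permutations are covered alike.
\<close>

lemma expectation_bound:
  assumes fin: "finite (set_pmf p)"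
    and marginal: "\<And>t. t < T \<Longrightarrow> map_pmf (\<lambda>\<pi>s. \<pi>s t) p = uniform_perm n"
  shows "measure_pmf.expectation p (\<lambda>\<pi>s. (norm (outer_iterate n f \<psi> (\<lambda>_. \<gamma>) x0 \<pi>s T - xs))\<^sup>2)
    \<le> (1 - \<gamma> * \<mu>) ^ (n * T) * (norm (x0 - xs))\<^sup>2 + 2 * \<gamma>\<^sup>2 * \<sigma>sq / \<mu>"
  using marginal
proof (induction T)
  case 0
  \<comment> \<open>With no epochs run, only nonnegativity of the noise term is at stake; it follows
    from the noise bound at index 0, whose left side is 0.\<close>
  have "0 \<le> \<gamma>\<^sup>2 * \<sigma>sq"
  proof -
    have "measure_pmf.expectation (uniform_perm n) (\<lambda>\<pi>. noise \<pi> 0) = 0"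
      by (simp add: noise_def opt_iterate_def bregman_def)
    then show ?thesis using expectation_noise[of 0] n by simp
  qed
  then have "0 \<le> 2 * \<gamma>\<^sup>2 * \<sigma>sq / \<mu>" using mu by (intro divide_nonneg_pos) (auto simp: mult.commute)
  then show ?case by simp
next
  case (Suc T)
  let ?q = "1 - \<gamma> * \<mu>" and ?B = "2 * \<gamma>\<^sup>2 * \<sigma>sq / \<mu>"
  let ?d = "\<lambda>\<pi>s. (norm (outer_iterate n f \<psi> (\<lambda>_. \<gamma>) x0 \<pi>s T - xs))\<^sup>2"
  let ?N = "\<lambda>\<pi>. 2 * \<gamma> * (\<Sum>i<n. ?q ^ (n - Suc i) * noise \<pi> i)"
  note int = integrable_measure_pmf_finite[OF fin]
  have marg: "map_pmf (\<lambda>\<pi>s. \<pi>s T) p = uniform_perm n" using Suc.prems by simp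
  have "\<pi>s T \<in> set_pmf (uniform_perm n)" if "\<pi>s \<in> set_pmf p" for \<pi>s
    using that by (simp flip: marg)
  then have "measure_pmf.expectation p
      (\<lambda>\<pi>s. (norm (outer_iterate n f \<psi> (\<lambda>_. \<gamma>) x0 \<pi>s (Suc T) - xs))\<^sup>2)
    \<le> measure_pmf.expectation p (\<lambda>\<pi>s. ?q ^ n * ?d \<pi>s + ?N (\<pi>s T))"
    by (intro integral_mono_AE int) (auto simp: AE_measure_pmf_iff intro: epoch_bound)
  also have "\<dots> = ?q ^ n * measure_pmf.expectation p ?d + measure_pmf.expectation p (\<lambda>\<pi>s. ?N (\<pi>s T))"
    by (subst Bochner_Integration.integral_add) (simp_all add: int)
  also have "measure_pmf.expectation p (\<lambda>\<pi>s. ?N (\<pi>s T)) = measure_pmf.expectation (uniform_perm n) ?N"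
    unfolding marg[symmetric] by simp
  \<comment> \<open>The weights \<open>?q ^ n\<close> and \<open>1 - ?q ^ n\<close> sum to 1, so
    \<open>?B\<close> carries over unchanged and does not accumulate.\<close>
  also have "?q ^ n * measure_pmf.expectation p ?d + \<dots>
      \<le> ?q ^ n * (?q ^ (n * T) * (norm (x0 - xs))\<^sup>2 + ?B) + (1 - ?q ^ n) * ?B"
    using Suc contraction_factor epoch_noise by (intro add_mono mult_left_mono) auto
  also have "\<dots> = ?q ^ (n * Suc T) * (norm (x0 - xs))\<^sup>2 + ?B"
    by (simp only: mult_Suc_right power_add) (simp only: algebra_simps)
  finally show ?case .
qed

end

section \<open>Finite support and marginals of the two schedules\<close>

lemma finite_rr_schedule: "finite (set_pmf (rr_schedule n T))"
  unfolding rr_schedule_def using finite_uniform_perm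
  by (intro finite_subset[OF set_Pi_pmf_subset'] finite_PiE_dflt) auto

text \<open>Only coordinates below \<open>T\<close> are uniform; later ones hold the dummy
  \<open>[]\<close>.\<close>

lemma rr_schedule_marginal:
  "t < T \<Longrightarrow> map_pmf (\<lambda>\<pi>s. \<pi>s t) (rr_schedule n T) = uniform_perm n"
  unfolding rr_schedule_def by (simp add: Pi_pmf_component)

lemma finite_so_schedule: "finite (set_pmf (so_schedule n))"
  unfolding so_schedule_def using finite_uniform_perm by simp

lemma so_schedule_marginal: "map_pmf (\<lambda>\<pi>s. \<pi>s t) (so_schedule n) = uniform_perm n"
  unfolding so_schedule_def by (simp add: pmf.map_comp o_def)

theorem theorem2:
  fixes f :: "nat \<Rightarrow> 'a::euclidean_space \<Rightarrow> real"
    and \<psi> :: "'a \<Rightarrow> ereal"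
    and L :: "nat \<Rightarrow> real"
    and \<mu> \<gamma> :: real
    and n T :: nat
    and x0 xs :: 'a
  assumes "n \<ge> 1"
    and "\<And>i. i \<in> {1..n} \<Longrightarrow> L i > 0"
    and "\<And>i. i \<in> {1..n} \<Longrightarrow> smooth_fun (L i) (f i)"
    and "\<mu> > 0"
    and "\<And>i. i \<in> {1..n} \<Longrightarrow> strongly_convex \<mu> (f i)"
    and "proper_fun \<psi>" and "closed_fun \<psi>" and "convex_fun \<psi>"
    and "is_arg_min (composite_objective n f \<psi>) (\<lambda>_. True) xs"
    and "0 < \<gamma>" and "\<gamma> \<le> 1 / Max (L ` {1..n})"
  shows "measure_pmf.expectation (rr_schedule n T)
           (\<lambda>\<pi>s. (norm (outer_iterate n f \<psi> (\<lambda>_. \<gamma>) x0 \<pi>s T - xs))\<^sup>2)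
         \<le> (1 - \<gamma> * \<mu>) ^ (n * T) * (norm (x0 - xs))\<^sup>2
           + 2 * \<gamma>\<^sup>2 * shuffling_radius_sq n f xs \<gamma> / \<mu>
       \<and> measure_pmf.expectation (so_schedule n)
           (\<lambda>\<pi>s. (norm (outer_iterate n f \<psi> (\<lambda>_. \<gamma>) x0 \<pi>s T - xs))\<^sup>2)
         \<le> (1 - \<gamma> * \<mu>) ^ (n * T) * (norm (x0 - xs))\<^sup>2
           + 2 * \<gamma>\<^sup>2 * shuffling_radius_sq n f xs \<gamma> / \<mu>"
proof -
  interpret prox_shuffling f \<psi> L \<mu> \<gamma> n xs
    using assms by unfold_locales
  show ?thesis
    by (intro conjI expectation_bound finite_rr_schedule rr_schedule_marginal
        finite_so_schedule so_schedule_marginal)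
qed

end
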